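(* Let $\mathcal S\subseteq\bigcup_n(M_n)^d_{sa}$ and $\mathcal T\subseteq\bigcup_n(M_n)^d_{sa}$ be matrix convex sets. Assume that there is a $k$-tuple $\lambda^{(1)},\dots,\lambda^{(k)}$ of real $d\times d$ rank one matrices such that $I_d\in\operatorname{conv}\{\lambda^{(1)},\dots,\lambda^{(k)}\}$ and such that $\lambda^{(m)}\mathcal S\subseteq\mathcal T$ for all $1\le m\le k$. Then for every $X\in\mathcal S$ there is a $d$-tuple $T=(T_1,\dots,T_d)$ of self-adjoint matrices such that (1) $\{T_1,\dots,T_d\}$ is a commuting family of operators, (2) $T\in\mathcal T$, (3) $X\prec T$, i.e. $T$ is a dilation of $X$.
   Context: $(M_n)^d_{sa}$ is the set of $d$-tuples of self-adjoint $n\times n$ complex matrices. A set $\mathcal S=\bigcup_n\mathcal S_n$ with $\mathcal S_n\subseteq(M_n)^d_{sa}$ is matrix convex if it is closed under direct sums and under unital completely positive maps (if $X\in\mathcal S_n$ and $\phi:M_n\to M_k$ is UCP then $(\phi(X_1),\dots,\phi(X_d))\in\mathcal S_k$). For a real $d\times d$ matrix $\gamma=[\gamma_{ij}]$, $\gamma\mathcal S$ is the set of all tuples $\big(\sum_j\gamma_{1j}X_j,\dots,\sum_j\gamma_{dj}X_j\big)$ with $X\in\mathcal S$. $X\prec T$ means there is an isometry $V$ with $X_i=V^*T_iV$ for all $i$. *)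

theory Defs
  imports
    "HOL-Analysis.Analysis"
    "Jordan_Normal_Form.Schur_Decomposition"
begin

no_notation vec_index (infixl \<open>$\<close> 100)

text \<open>
  The number \<open>d\<close> is the cardinality of the finite index type \<open>'d\<close>; a \<open>d\<close>-tuple of matrices is a
  function on \<open>'d\<close>. The matrix size \<open>n\<close> varies, so the entries are carrier-based matrices.
  A graded set (the union over \<open>n\<close> of sets of tuples of \<open>n\<close> by \<open>n\<close> matrices) is a plain set of
  tuples, the grade being recovered from the dimensions. Sizes are positive throughout.
\<close>

definition sa_tuples :: "nat \<Rightarrow> ('d \<Rightarrow> complex mat) set" where
  "sa_tuples n = {X. \<forall>i. X i \<in> carrier_mat n n \<and> mat_adjoint (X i) = X i}"

text \<open>Over the complex numbers, \<open>0 \<le> z\<close> says that \<open>z\<close> is real and nonnegative.\<close>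

definition psd_mat :: "nat \<Rightarrow> complex mat \<Rightarrow> bool" where
  "psd_mat n A \<longleftrightarrow> A \<in> carrier_mat n n \<and> (\<forall>v\<in>carrier_vec n. 0 \<le> (A *\<^sub>v v) \<bullet>c v)"

definition linear_mat_map :: "nat \<Rightarrow> nat \<Rightarrow> (complex mat \<Rightarrow> complex mat) \<Rightarrow> bool" where
  "linear_mat_map n k \<phi> \<longleftrightarrow>
     (\<forall>A\<in>carrier_mat n n. \<phi> A \<in> carrier_mat k k) \<and>
     (\<forall>A\<in>carrier_mat n n. \<forall>B\<in>carrier_mat n n. \<phi> (A + B) = \<phi> A + \<phi> B) \<and>
     (\<forall>c. \<forall>A\<in>carrier_mat n n. \<phi> (c \<cdot>\<^sub>m A) = c \<cdot>\<^sub>m \<phi> A)"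

text \<open>An \<open>m * n\<close> by \<open>m * n\<close> matrix is read as an \<open>m\<close> by \<open>m\<close> array of blocks of size \<open>n\<close>.\<close>

definition block_of :: "nat \<Rightarrow> complex mat \<Rightarrow> nat \<Rightarrow> nat \<Rightarrow> complex mat" where
  "block_of n A a b = Matrix.mat n n (\<lambda>(r, c). A $$ (a * n + r, b * n + c))"

text \<open>The map \<open>[A\<^sub>a\<^sub>b] \<mapsto> [\<phi> A\<^sub>a\<^sub>b]\<close> from \<open>M\<^sub>m(M\<^sub>n)\<close> to \<open>M\<^sub>m(M\<^sub>k)\<close>.\<close>

definition ampliation ::
    "nat \<Rightarrow> nat \<Rightarrow> nat \<Rightarrow> (complex mat \<Rightarrow> complex mat) \<Rightarrow> complex mat \<Rightarrow> complex mat" where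
  "ampliation m n k \<phi> A =
     Matrix.mat (m * k) (m * k)
       (\<lambda>(r, c). \<phi> (block_of n A (r div k) (c div k)) $$ (r mod k, c mod k))"

definition completely_positive :: "nat \<Rightarrow> nat \<Rightarrow> (complex mat \<Rightarrow> complex mat) \<Rightarrow> bool" where
  "completely_positive n k \<phi> \<longleftrightarrow>
     linear_mat_map n k \<phi> \<and>
     (\<forall>m A. psd_mat (m * n) A \<longrightarrow> psd_mat (m * k) (ampliation m n k \<phi> A))"

definition ucp :: "nat \<Rightarrow> nat \<Rightarrow> (complex mat \<Rightarrow> complex mat) \<Rightarrow> bool" where
  "ucp n k \<phi> \<longleftrightarrow> completely_positive n k \<phi> \<and> \<phi> (1\<^sub>m n) = 1\<^sub>m k"

definition direct_sum :: "complex mat \<Rightarrow> complex mat \<Rightarrow> complex mat" where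
  "direct_sum A B =
     four_block_mat A (0\<^sub>m (dim_row A) (dim_col B)) (0\<^sub>m (dim_row B) (dim_col A)) B"

definition matrix_convex :: "('d \<Rightarrow> complex mat) set \<Rightarrow> bool" where
  "matrix_convex S \<longleftrightarrow>
     S \<subseteq> (\<Union>n\<in>{1..}. sa_tuples n) \<and>
     (\<forall>X\<in>S. \<forall>Y\<in>S. (\<lambda>i. direct_sum (X i) (Y i)) \<in> S) \<and>
     (\<forall>n\<ge>1. \<forall>k\<ge>1. \<forall>\<phi>. \<forall>X \<in> S \<inter> sa_tuples n. ucp n k \<phi> \<longrightarrow> (\<lambda>i. \<phi> (X i)) \<in> S)"

text \<open>
  The tuple with entries \<open>\<Sum>\<^sub>j \<gamma>\<^sub>i\<^sub>j X\<^sub>j\<close>. The sum is written entrywise because the type of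
  carrier-based matrices is not an additive monoid; all \<open>X j\<close> have the same dimensions.
\<close>

definition tuple_transform ::
    "real^'d^'d \<Rightarrow> ('d::finite \<Rightarrow> complex mat) \<Rightarrow> ('d \<Rightarrow> complex mat)" where
  "tuple_transform \<gamma> X =
     (\<lambda>i. Matrix.mat (dim_row (X i)) (dim_col (X i))
            (\<lambda>(r, c). \<Sum>j\<in>UNIV. complex_of_real (\<gamma> $ i $ j) * X j $$ (r, c)))"

definition dilation :: "('d \<Rightarrow> complex mat) \<Rightarrow> ('d \<Rightarrow> complex mat) \<Rightarrow> bool" (infix \<open>\<prec>\<^sub>d\<close> 50) where
  "X \<prec>\<^sub>d T \<longleftrightarrow>
     (\<exists>n N V. (\<forall>i. X i \<in> carrier_mat n n) \<and> (\<forall>i. T i \<in> carrier_mat N N) \<and>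
        V \<in> carrier_mat N n \<and> mat_adjoint V * V = 1\<^sub>m n \<and>
        (\<forall>i. X i = mat_adjoint V * T i * V))"

end

theory Submission
  imports Defs
begin

text \<open>
  Fix \<open>X \<in> S\<close> and consider the real matrices \<open>\<gamma>\<close> for which \<open>\<gamma>X\<close> dilates to a commuting tuple in
  \<open>T\<close>. They form a convex set: if \<open>\<gamma>X\<close> and \<open>\<delta>X\<close> are compressed from \<open>Y\<close> and \<open>Z\<close> by \<open>V\<close> and \<open>W\<close>, then
  \<open>u\<gamma>X + v\<delta>X\<close> is compressed from \<open>Y \<oplus> Z\<close> by the column with blocks \<open>\<surd>u V\<close> and \<open>\<surd>v W\<close>. Each rank
  one \<open>\<lambda>\<close> with \<open>\<lambda>S \<subseteq> T\<close> belongs to this set, because the entries of \<open>\<lambda>X\<close> are multiples of a single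
  matrix. Hence so does the identity.
\<close>

section \<open>Adjoints, direct sums and compressions\<close>

lemma mat_adjoint_carrier [simp]:
  "A \<in> carrier_mat n m \<Longrightarrow> mat_adjoint A \<in> carrier_mat m n"
  by (auto simp: mat_adjoint_def)

lemma dim_mat_adjoint [simp]:
  "dim_row (mat_adjoint A) = dim_col A" "dim_col (mat_adjoint A) = dim_row A"
  by (auto simp: mat_adjoint_def)

lemma index_mat_adjoint [simp]:
  "i < dim_col A \<Longrightarrow> j < dim_row A \<Longrightarrow> mat_adjoint A $$ (i, j) = conjugate (A $$ (j, i))"
  by (simp add: mat_adjoint_def mat_of_rows_def)

lemma mat_adjoint_one [simp]: "mat_adjoint (1\<^sub>m n :: complex mat) = 1\<^sub>m n"
  by (rule eq_matI) auto

lemma mat_adjoint_smult: "mat_adjoint (c \<cdot>\<^sub>m A) = conjugate c \<cdot>\<^sub>m mat_adjoint A"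
  by (rule eq_matI) (auto simp: conjugate_dist_mul)

lemma mat_adjoint_four_block:
  assumes "A \<in> carrier_mat nr1 nc1" "B \<in> carrier_mat nr1 nc2"
    "C \<in> carrier_mat nr2 nc1" "D \<in> carrier_mat nr2 nc2"
  shows "mat_adjoint (four_block_mat A B C D) =
    four_block_mat (mat_adjoint A) (mat_adjoint C) (mat_adjoint B) (mat_adjoint D)"
  by (rule eq_matI) (use assms in auto)

lemma mat_adjoint_zero [simp]: "mat_adjoint (0\<^sub>m n m :: complex mat) = 0\<^sub>m m n"
  by (rule eq_matI) auto

lemma direct_sum_carrier [simp]:
  "A \<in> carrier_mat n n \<Longrightarrow> B \<in> carrier_mat m m \<Longrightarrow> direct_sum A B \<in> carrier_mat (n + m) (n + m)"
  by (auto simp: direct_sum_def)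

text \<open>Block-diagonal products have no cross terms; this is how commutation will pass to direct
  sums.\<close>

lemma direct_sum_mult:
  assumes "A \<in> carrier_mat n n" "A' \<in> carrier_mat n n" "B \<in> carrier_mat m m" "B' \<in> carrier_mat m m"
  shows "direct_sum A B * direct_sum A' B' = direct_sum (A * A') (B * B')"
proof -
  have "direct_sum A B * direct_sum A' B' =
      four_block_mat A (0\<^sub>m n m) (0\<^sub>m m n) B * four_block_mat A' (0\<^sub>m n m) (0\<^sub>m m n) B'"
    using assms by (simp add: direct_sum_def)
  also have "\<dots> = direct_sum (A * A') (B * B')"
    using assms by (subst mult_four_block_mat[of _ n n _ m _ m _ _ n _ m]) (auto simp: direct_sum_def)
  finally show ?thesis .
qed

lemma direct_sum_sa_tuples:
  assumes "Y \<in> sa_tuples n" "Z \<in> sa_tuples m"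
  shows "(\<lambda>i. direct_sum (Y i) (Z i)) \<in> sa_tuples (n + m)"
proof -
  have "mat_adjoint (direct_sum (Y i) (Z i)) = direct_sum (Y i) (Z i)" for i
  proof -
    have "Y i \<in> carrier_mat n n" "Z i \<in> carrier_mat m m"
      "mat_adjoint (Y i) = Y i" "mat_adjoint (Z i) = Z i"
      using assms by (auto simp: sa_tuples_def)
    then show ?thesis
      by (simp add: direct_sum_def mat_adjoint_four_block[of _ n n _ m _ m])
  qed
  with assms show ?thesis by (auto simp: sa_tuples_def)
qed

text \<open>\<open>V\<close> stacked on \<open>W\<close> is a block column, and the zero
  off-diagonal blocks of \<open>direct_sum A B\<close> kill the cross terms between \<open>V\<close>
  and \<open>W\<close>.\<close>

lemma compress_direct_sum:
  assumes V: "V \<in> carrier_mat N n" and W: "W \<in> carrier_mat M n"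
    and A: "A \<in> carrier_mat N N" and B: "B \<in> carrier_mat M M"
  shows "mat_adjoint (V @\<^sub>r W) * direct_sum A B * (V @\<^sub>r W) =
    mat_adjoint V * A * V + mat_adjoint W * B * W"
proof -
  \<comment> \<open>\<open>append_rows\<close> is a four-block matrix whose right-hand blocks have
    width 0, so its adjoint has lower blocks of height 0.\<close>
  have adj: "mat_adjoint (V @\<^sub>r W) =
      four_block_mat (mat_adjoint V) (mat_adjoint W) (0\<^sub>m 0 N) (0\<^sub>m 0 M)"
    using V W by (simp add: append_rows_def mat_adjoint_four_block[of _ N n _ 0 _ M])
  have "mat_adjoint (V @\<^sub>r W) * direct_sum A B =
      four_block_mat (mat_adjoint V) (mat_adjoint W) (0\<^sub>m 0 N) (0\<^sub>m 0 M) *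
      four_block_mat A (0\<^sub>m N M) (0\<^sub>m M N) B"
    using A B by (simp add: adj direct_sum_def)
  also have "\<dots> = four_block_mat (mat_adjoint V * A) (mat_adjoint W * B) (0\<^sub>m 0 N) (0\<^sub>m 0 M)"
    using assms by (subst mult_four_block_mat[of _ n N _ M _ 0 _ _ N _ M]) auto
  finally have "mat_adjoint (V @\<^sub>r W) * direct_sum A B * (V @\<^sub>r W) =
      four_block_mat (mat_adjoint V * A) (mat_adjoint W * B) (0\<^sub>m 0 N) (0\<^sub>m 0 M) *
      four_block_mat V (0\<^sub>m N 0) W (0\<^sub>m M 0)"
    using V W by (simp add: append_rows_def)
  also have "\<dots> = four_block_mat (mat_adjoint V * A * V + mat_adjoint W * B * W)
      (0\<^sub>m n 0) (0\<^sub>m 0 n) (0\<^sub>m 0 0)"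
  proof -
    have "mat_adjoint V * A \<in> carrier_mat n N" "mat_adjoint W * B \<in> carrier_mat n M"
      using assms by (auto intro!: mult_carrier_mat mat_adjoint_carrier)
    then show ?thesis
      using V W mult_four_block_mat[of "mat_adjoint V * A" n N "mat_adjoint W * B" M "0\<^sub>m 0 N" 0
        "0\<^sub>m 0 M" V n "0\<^sub>m N 0" 0 W "0\<^sub>m M 0"]
      by (simp add: right_mult_zero_mat[of _ n N] right_mult_zero_mat[of _ n M])
  qed
  \<comment> \<open>The three empty blocks contribute no entries, so only the upper left block
    remains.\<close>
  also have "\<dots> = mat_adjoint V * A * V + mat_adjoint W * B * W"
    using assms by (intro eq_matI) auto
  finally show ?thesis .
qed

text \<open>A real scalar is its own conjugate, so it comes out once from each side. With
  \<open>t\<close> a square root, the factor is a prescribed nonnegative weight.\<close>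

lemma compress_smult:
  fixes A :: "complex mat"
  assumes "V \<in> carrier_mat N n" "A \<in> carrier_mat N N"
  shows "mat_adjoint (complex_of_real t \<cdot>\<^sub>m V) * A * (complex_of_real t \<cdot>\<^sub>m V) =
    complex_of_real (t\<^sup>2) \<cdot>\<^sub>m (mat_adjoint V * A * V)"
proof -
  have *: "mat_adjoint V \<in> carrier_mat n N" "mat_adjoint V * A \<in> carrier_mat n N"
    using assms by (auto intro!: mult_carrier_mat mat_adjoint_carrier)
  have "mat_adjoint (complex_of_real t \<cdot>\<^sub>m V) * A * (complex_of_real t \<cdot>\<^sub>m V) =
      complex_of_real t \<cdot>\<^sub>m (complex_of_real t \<cdot>\<^sub>m (mat_adjoint V * A * V))"
    using assms * by (simp add: mat_adjoint_smult smult_carrier_mat mult_smult_assoc_mat[of _ n N]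
      mult_smult_distrib[of _ n N _ n])
  also have "\<dots> = complex_of_real (t\<^sup>2) \<cdot>\<^sub>m (mat_adjoint V * A * V)"
    by (rule eq_matI) (auto simp: power2_eq_square)
  finally show ?thesis .
qed

section \<open>Transforms of tuples by real matrices\<close>

lemma tuple_transform_sa_carrier:
  "X \<in> sa_tuples n \<Longrightarrow> tuple_transform \<gamma> X i \<in> carrier_mat n n"
  unfolding sa_tuples_def tuple_transform_def
  by (metis (no_types, lifting) carrier_matD mat_carrier mem_Collect_eq)

lemma tuple_transform_combination:
  "tuple_transform (u *\<^sub>R \<gamma> + v *\<^sub>R \<delta>) X i =
    complex_of_real u \<cdot>\<^sub>m tuple_transform \<gamma> X i + complex_of_real v \<cdot>\<^sub>m tuple_transform \<delta> X i"
  by (rule eq_matI)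
    (auto simp: tuple_transform_def sum.distrib sum_distrib_left algebra_simps)

lemma tuple_transform_one: "tuple_transform (Finite_Cartesian_Product.mat 1) X = X"
proof
  fix i
  have "(\<Sum>j\<in>UNIV. complex_of_real (Finite_Cartesian_Product.mat 1 $ i $ j) * X j $$ p) = X i $$ p"
    for p
    by (subst sum.remove[of _ i]) (auto simp: Finite_Cartesian_Product.mat_def)
  then show "tuple_transform (Finite_Cartesian_Product.mat 1) X i = X i"
    by (intro eq_matI) (auto simp: tuple_transform_def)
qed

text \<open>The row space has a basis with a single vector \<open>b\<close>, so every row is a
  multiple of \<open>b\<close>; the factors form \<open>a\<close>.\<close>

lemma rank_one_outer_product:
  fixes A :: "real^'n^'m"
  assumes "rank A = 1"
  obtains a b where "\<And>i j. A $ i $ j = a i * b j"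
proof -
  obtain B where B: "Finite_Cartesian_Product.rows A \<subseteq> span B" "card B = 1"
    using basis_exists[of "Finite_Cartesian_Product.rows A"] assms unfolding row_rank_def by metis
  then obtain b where "B = {b}" by (auto simp: card_1_singleton_iff)
  with B have "A $ i \<in> span {b}" for i
    by (auto simp: Finite_Cartesian_Product.rows_def Finite_Cartesian_Product.row_def)
  then have "\<forall>i. \<exists>c. A $ i = c *\<^sub>R b" by (auto simp: span_singleton)
  then obtain a where "\<forall>i. A $ i = a i *\<^sub>R b" by metis
  then show ?thesis by (intro that[of a "\<lambda>j. b $ j"]) simp
qed

text \<open>Writing \<gamma> as an outer product of \<open>a\<close> and \<open>b\<close>, each
  entry is \<open>a i\<close> times the common matrix \<open>Z\<close>, the combination of the
  \<open>X j\<close> with weights \<open>b j\<close>. Each product is then \<open>a i * a j\<close>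
  times the square of \<open>Z\<close>, which is symmetric in \<open>i\<close> and
  \<open>j\<close>.\<close>

lemma tuple_transform_rank_one_commute:
  assumes X: "X \<in> sa_tuples n" and "rank \<gamma> = 1"
  shows "tuple_transform \<gamma> X i * tuple_transform \<gamma> X j =
    tuple_transform \<gamma> X j * tuple_transform \<gamma> X i"
proof -
  obtain a b where ab: "\<And>i j. \<gamma> $ i $ j = a i * b j"
    using rank_one_outer_product[OF assms(2)] by blast
  define Z where "Z = Matrix.mat n n (\<lambda>p. \<Sum>j\<in>UNIV. complex_of_real (b j) * X j $$ p)"
  have Z: "Z \<in> carrier_mat n n" by (simp add: Z_def)
  have XZ: "tuple_transform \<gamma> X i = complex_of_real (a i) \<cdot>\<^sub>m Z" for i
  proof -
    have "X i \<in> carrier_mat n n" using X by (auto simp: sa_tuples_def)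
    then show ?thesis
      by (intro eq_matI) (auto simp: tuple_transform_def Z_def ab sum_distrib_left mult.assoc)
  qed
  have "tuple_transform \<gamma> X i * tuple_transform \<gamma> X j =
      (complex_of_real (a i) * complex_of_real (a j)) \<cdot>\<^sub>m (Z * Z)" for i j
  proof -
    have "tuple_transform \<gamma> X i * tuple_transform \<gamma> X j =
        complex_of_real (a j) \<cdot>\<^sub>m (complex_of_real (a i) \<cdot>\<^sub>m (Z * Z))"
      using Z by (simp add: XZ smult_carrier_mat mult_smult_assoc_mat[of _ n n]
        mult_smult_distrib[of _ n n _ n])
    also have "\<dots> = (complex_of_real (a i) * complex_of_real (a j)) \<cdot>\<^sub>m (Z * Z)"
      by (rule eq_matI) auto
    finally show ?thesis .
  qed
  then show ?thesis by (simp add: mult.commute)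
qed

section \<open>Commuting tuples and convexity of the set of good transforms\<close>

definition commuting_sa :: "('d \<Rightarrow> complex mat) \<Rightarrow> bool" where
  "commuting_sa Y \<longleftrightarrow> (\<exists>N\<ge>1. Y \<in> sa_tuples N) \<and> (\<forall>i j. Y i * Y j = Y j * Y i)"

lemma commuting_sa_direct_sum:
  assumes "commuting_sa Y" "commuting_sa Z"
  shows "commuting_sa (\<lambda>i. direct_sum (Y i) (Z i))"
proof -
  obtain N M where NM: "N \<ge> 1" "Y \<in> sa_tuples N" "M \<ge> 1" "Z \<in> sa_tuples M"
    using assms by (auto simp: commuting_sa_def)
  then have "Y i \<in> carrier_mat N N" "Z i \<in> carrier_mat M M" for i
    by (auto simp: sa_tuples_def)
  then have "direct_sum (Y i) (Z i) * direct_sum (Y j) (Z j) =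
      direct_sum (Y j) (Z j) * direct_sum (Y i) (Z i)" for i j
    using assms by (simp add: direct_sum_mult[of _ N _ _ M] commuting_sa_def)
  moreover have "N + M \<ge> 1" using NM by simp
  ultimately show ?thesis
    unfolding commuting_sa_def using direct_sum_sa_tuples NM by blast
qed

lemma dilation_combination:
  fixes \<gamma> \<delta> :: "real^'d^'d"
  assumes Y: "tuple_transform \<gamma> X \<prec>\<^sub>d Y" and Z: "tuple_transform \<delta> X \<prec>\<^sub>d Z"
    and X: "X \<in> sa_tuples n" and uv: "u \<ge> 0" "v \<ge> 0" "u + v = 1"
  shows "tuple_transform (u *\<^sub>R \<gamma> + v *\<^sub>R \<delta>) X \<prec>\<^sub>d (\<lambda>i. direct_sum (Y i) (Z i))"
proof -
  note car = tuple_transform_sa_carrier[OF X]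
  \<comment> \<open>The sizes inside \<open>dilation\<close> are existential; \<open>car\<close>
    identifies the smaller one with \<open>n\<close>, so \<open>V\<close> and the later
    \<open>W\<close> have equally many columns and can be stacked.\<close>
  obtain N V where V: "\<And>i. Y i \<in> carrier_mat N N" "V \<in> carrier_mat N n"
      "mat_adjoint V * V = 1\<^sub>m n" "\<And>i. tuple_transform \<gamma> X i = mat_adjoint V * Y i * V"
    using Y car[of \<gamma>] unfolding dilation_def by (metis carrier_matD(1))
  obtain M W where W: "\<And>i. Z i \<in> carrier_mat M M" "W \<in> carrier_mat M n"
      "mat_adjoint W * W = 1\<^sub>m n" "\<And>i. tuple_transform \<delta> X i = mat_adjoint W * Z i * W"
    using Z car[of \<delta>] unfolding dilation_def by (metis carrier_matD(1))
  let ?V = "complex_of_real (sqrt u) \<cdot>\<^sub>m V" and ?W = "complex_of_real (sqrt v) \<cdot>\<^sub>m W"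
  have U: "?V @\<^sub>r ?W \<in> carrier_mat (N + M) n"
    using V W by (auto intro!: carrier_append_rows)
  have compress: "mat_adjoint (?V @\<^sub>r ?W) * direct_sum A B * (?V @\<^sub>r ?W) =
      complex_of_real u \<cdot>\<^sub>m (mat_adjoint V * A * V) + complex_of_real v \<cdot>\<^sub>m (mat_adjoint W * B * W)"
    if "A \<in> carrier_mat N N" "B \<in> carrier_mat M M" for A B
    using that V(2) W(2) uv
    by (simp add: compress_direct_sum[of _ N n _ M] compress_smult[of _ N n]
      compress_smult[of _ M n])
  \<comment> \<open>Inserting the identity as a direct sum lets \<open>compress\<close> also show
    that the column is an isometry: the result is \<open>u + v = 1\<close> times the
    identity.\<close>
  have "direct_sum (1\<^sub>m N) (1\<^sub>m M) = (1\<^sub>m (N + M) :: complex mat)"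
    by (simp add: direct_sum_def)
  then have "mat_adjoint (?V @\<^sub>r ?W) * (?V @\<^sub>r ?W) =
      mat_adjoint (?V @\<^sub>r ?W) * direct_sum (1\<^sub>m N) (1\<^sub>m M) * (?V @\<^sub>r ?W)"
    by (simp add: right_mult_one_mat[OF mat_adjoint_carrier[OF U]])
  also have "\<dots> = complex_of_real u \<cdot>\<^sub>m 1\<^sub>m n + complex_of_real v \<cdot>\<^sub>m 1\<^sub>m n"
    using V(3) W(3) mat_adjoint_carrier[OF V(2)] mat_adjoint_carrier[OF W(2)]
    by (simp add: compress right_mult_one_mat[of _ n N] right_mult_one_mat[of _ n M])
  also have "\<dots> = 1\<^sub>m n"
  proof -
    have "complex_of_real u + complex_of_real v = 1"
      using uv(3) by (metis of_real_1 of_real_add)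
    then show ?thesis by (intro eq_matI) auto
  qed
  finally have iso: "mat_adjoint (?V @\<^sub>r ?W) * (?V @\<^sub>r ?W) = 1\<^sub>m n" .
  have "tuple_transform (u *\<^sub>R \<gamma> + v *\<^sub>R \<delta>) X i =
      mat_adjoint (?V @\<^sub>r ?W) * direct_sum (Y i) (Z i) * (?V @\<^sub>r ?W)" for i
    using V W by (simp add: compress tuple_transform_combination)
  with iso U V(1) W(1) car show ?thesis
    unfolding dilation_def by (metis direct_sum_carrier)
qed

text \<open>With \<open>X\<close> fixed and \<gamma> varying, \<open>dilation_combination\<close>
  supplies the dilation of a convex combination, and closure of \<open>T\<close> under direct sums
  keeps it in \<open>T\<close>.\<close>

lemma convex_dilation_set:
  fixes T :: "('d::finite \<Rightarrow> complex mat) set"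
  assumes X: "X \<in> sa_tuples n" and T: "matrix_convex T"
  shows "convex {\<gamma>. \<exists>Y\<in>T. commuting_sa Y \<and> tuple_transform \<gamma> X \<prec>\<^sub>d Y}"
proof (rule convexI)
  fix \<gamma> \<delta> :: "real^'d^'d" and u v :: real
  assume "0 \<le> u" "0 \<le> v" "u + v = 1"
    and "\<gamma> \<in> {\<gamma>. \<exists>Y\<in>T. commuting_sa Y \<and> tuple_transform \<gamma> X \<prec>\<^sub>d Y}"
    and "\<delta> \<in> {\<gamma>. \<exists>Y\<in>T. commuting_sa Y \<and> tuple_transform \<gamma> X \<prec>\<^sub>d Y}"
  moreover have "(\<lambda>i. direct_sum (Y i) (Z i)) \<in> T" if "Y \<in> T" "Z \<in> T" for Y Z
    using T that by (auto simp: matrix_convex_def)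
  ultimately show "u *\<^sub>R \<gamma> + v *\<^sub>R \<delta> \<in> {\<gamma>. \<exists>Y\<in>T. commuting_sa Y \<and> tuple_transform \<gamma> X \<prec>\<^sub>d Y}"
    using dilation_combination[OF _ _ X] commuting_sa_direct_sum
    by (smt (verit, best) mem_Collect_eq)
qed

lemma dilation_refl:
  assumes "\<And>i. Y i \<in> carrier_mat n n"
  shows "Y \<prec>\<^sub>d Y"
  unfolding dilation_def
  by (intro exI[of _ n] exI[of _ "1\<^sub>m n"])
    (use assms in \<open>auto simp: left_mult_one_mat[of _ n n] right_mult_one_mat[of _ n n]\<close>)

theorem theorem7p7:
  fixes S T :: "('d::finite \<Rightarrow> complex mat) set"
    and L :: "nat \<Rightarrow> real^'d^'d"
    and k :: nat
  assumes "matrix_convex S"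
    and "matrix_convex T"
    and "\<forall>m\<in>{1..k}. rank (L m) = 1"
    and "Finite_Cartesian_Product.mat 1 \<in> convex hull (L ` {1..k})"
    and "\<forall>m\<in>{1..k}. tuple_transform (L m) ` S \<subseteq> T"
  shows "\<forall>X\<in>S. \<exists>Y.
     (\<exists>N\<ge>1. Y \<in> sa_tuples N) \<and>
     (\<forall>i j. Y i * Y j = Y j * Y i) \<and>
     Y \<in> T \<and>
     X \<prec>\<^sub>d Y"
proof
  fix X assume "X \<in> S"
  with assms(1) obtain n where X: "X \<in> sa_tuples n"
    by (auto simp: matrix_convex_def)
  let ?G = "{\<gamma>. \<exists>Y\<in>T. commuting_sa Y \<and> tuple_transform \<gamma> X \<prec>\<^sub>d Y}"
  have "L m \<in> ?G" if m: "m \<in> {1..k}" for m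
  proof -
    \<comment> \<open>The rank one image of \<open>X\<close> already commutes and lies in
      \<open>T\<close>, so it serves as its own dilation, with the identity as isometry.\<close>
    let ?Y = "tuple_transform (L m) X"
    have "?Y \<in> T" using assms(5) m \<open>X \<in> S\<close> by blast
    \<comment> \<open>Self-adjointness is read off from membership in \<open>T\<close>, whose
      elements are all self-adjoint tuples.\<close>
    moreover from this assms(2) have "\<exists>N\<ge>1. ?Y \<in> sa_tuples N"
      by (auto simp: matrix_convex_def)
    then have "commuting_sa ?Y"
      using tuple_transform_rank_one_commute[OF X] assms(3) m by (auto simp: commuting_sa_def)
    moreover have "?Y \<prec>\<^sub>d ?Y"
      using tuple_transform_sa_carrier[OF X] by (rule dilation_refl)
    ultimately show ?thesis by blast
  qed
  then have "convex hull (L ` {1..k}) \<subseteq> ?G"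
    using convex_dilation_set[OF X assms(2)] by (intro hull_minimal) auto
  \<comment> \<open>The identity matrix lies in the hull, hence in \<open>?G\<close>, and it
    transforms \<open>X\<close> into \<open>X\<close> itself.\<close>
  with assms(4) obtain Y where "Y \<in> T" "commuting_sa Y"
      "tuple_transform (Finite_Cartesian_Product.mat 1) X \<prec>\<^sub>d Y"
    by auto
  then show "\<exists>Y. (\<exists>N\<ge>1. Y \<in> sa_tuples N) \<and> (\<forall>i j. Y i * Y j = Y j * Y i) \<and> Y \<in> T \<and> X \<prec>\<^sub>d Y"
    by (auto simp: commuting_sa_def tuple_transform_one)
qed

end
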